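(* Let $S$ be a finite nonempty set of primes and let $m=\gcd\{p-1 : p\in S\}$. Then there exists $K\in\mathbb{N}$ such that for every integer $k\ge K$ with $k\equiv 1\pmod{m}$ there exist positive $S$-units $u_1,u_2,\dots,u_k$ such that $$u_1+u_2+\cdots+u_k=1$$ and $$u_i+u_{i+1}+\cdots+u_j\notin\mathbb{Z}_S^*\quad\text{for all } 1\le i<j\le k,\ (i,j)\ne(1,k).$$
   Context: For a finite nonempty set $S$ of primes, $\mathbb{Z}_S$ is the ring of rational numbers whose denominators (in lowest terms) are not divisible by any prime outside $S$, and $\mathbb{Z}_S^*$ is its group of invertible elements, called $S$-units. *)

theory Defs
  imports Complex_Main "HOL-Computational_Algebra.Primes" "HOL-Number_Theory.Cong"
begin

definition S_integers :: "nat set \<Rightarrow> rat set" where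
  "S_integers S =
     {r. \<forall>p::nat. prime p \<and> p \<notin> S \<longrightarrow> \<not> int p dvd snd (quotient_of r)}"

definition S_units :: "nat set \<Rightarrow> rat set" where
  "S_units S = {u \<in> S_integers S. \<exists>v \<in> S_integers S. u * v = 1}"

end

theory Submission
  imports Defs
begin

text \<open>
  Let \<open>G\<close> be the product of \<open>S\<close>. Repeating the block \<open>1, G, \<dots>, G^(N-1)\<close> exactly \<open>G - 1\<close> times
  and appending a final \<open>1\<close> gives \<open>N (G - 1) + 1\<close> \<open>S\<close>-units with sum \<open>G^N\<close>. A window inside one
  block has the form \<open>G^a (1 + G x)\<close> with \<open>x > 0\<close>, and \<open>1 + G x\<close> is coprime to \<open>S\<close>. A longer
  proper window \<open>w\<close> satisfies \<open>(G - 1) w \<equiv> -(d + G^a - G^b)\<close> modulo \<open>G^N\<close> with \<open>0 < d < G\<close>; the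
  valuations of \<open>d + G^a - G^b\<close> at the primes in \<open>S\<close> are bounded independently of \<open>N\<close>, whereas \<open>w\<close>
  is at least \<open>G^(N-1)\<close>, so \<open>w\<close> exceeds its \<open>S\<close>-part.

  Neither argument is affected by adding multiples of \<open>G^N\<close> to \<open>w\<close>. Hence further terms \<open>G^N y\<close> can
  be interleaved, where the \<open>R\<close> numbers \<open>y\<close> are \<open>S\<close>-units and 1 plus their sum is an \<open>S\<close>-unit.
  The possible values of \<open>R\<close> are closed under addition and contain \<open>p - 1\<close> for \<open>p\<close> in \<open>S\<close>, so they
  include all large multiples of \<open>m\<close>, and bounded \<open>R\<close> suffice to reach every \<open>k\<close>.
\<close>

section \<open>Positive integers composed of primes in \<open>S\<close>, and their relation to
  \<open>S\<close>-units\<close>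

definition smooth :: "nat set \<Rightarrow> nat \<Rightarrow> bool" where
  "smooth S n \<longleftrightarrow> n > 0 \<and> (\<forall>p. prime p \<and> p dvd n \<longrightarrow> p \<in> S)"

lemma smooth_1 [simp]: "smooth S 1" "smooth S (Suc 0)"
  by (auto simp: smooth_def)

lemma smooth_mult_iff: "smooth S (a * b) \<longleftrightarrow> smooth S a \<and> smooth S b"
  by (auto simp: smooth_def prime_dvd_mult_iff)

lemma smooth_power: "smooth S a \<Longrightarrow> smooth S (a ^ n)"
  by (induction n) (auto simp: smooth_mult_iff)

lemma smooth_prime: "prime p \<Longrightarrow> p \<in> S \<Longrightarrow> smooth S p"
  by (auto simp: smooth_def prime_gt_0_nat dest: primes_dvd_imp_eq)

lemma smooth_prod: "(\<And>x. x \<in> A \<Longrightarrow> smooth S (f x)) \<Longrightarrow> smooth S (prod f A)"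
  by (induction A rule: infinite_finite_induct) (auto simp: smooth_mult_iff)

text \<open>Frees the denominator from lowest terms: the reduced denominator is coprime to its
  numerator, so cross-multiplication makes it divide \<open>d\<close>.\<close>

lemma S_integers_iff:
  "r \<in> S_integers S \<longleftrightarrow> (\<exists>n d. smooth S d \<and> r = of_int n / of_nat d)"
proof
  assume r: "r \<in> S_integers S"
  obtain a b where ab: "quotient_of r = (a, b)" by force
  have b: "b > 0" using quotient_of_denom_pos[OF ab] .
  have "smooth S (nat b)" unfolding smooth_def
  proof (intro conjI allI impI)
    fix p :: nat assume p: "prime p \<and> p dvd nat b"
    then have "int p dvd b" using b by (simp add: nat_dvd_iff int_dvd_int_iff flip: int_dvd_int_iff)
    then show "p \<in> S" using r ab p by (auto simp: S_integers_def)
  qed (use b in simp)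
  moreover have "r = of_int a / of_nat (nat b)"
    using quotient_of_div[OF ab] b by simp
  ultimately show "\<exists>n d. smooth S d \<and> r = of_int n / of_nat d" by blast
next
  assume "\<exists>n d. smooth S d \<and> r = of_int n / of_nat d"
  then obtain n d where d: "smooth S d" and r: "r = of_int n / of_nat d" by blast
  obtain a b where ab: "quotient_of r = (a, b)" by force
  have b: "b > 0" using quotient_of_denom_pos[OF ab] .
  have d0: "d > 0" using d by (simp add: smooth_def)
  have "of_int a / of_int b = (of_int n / of_int (int d) :: rat)"
    using quotient_of_div[OF ab] r by simp
  then have "of_int (a * int d) = (of_int (n * b) :: rat)"
    using b d0 by (simp add: frac_eq_eq)
  then have "a * int d = n * b" by (simp only: of_int_eq_iff)
  then have "b dvd a * int d" by simp
  moreover have "coprime b a" using quotient_of_coprime[OF ab] by (simp add: coprime_commute)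
  ultimately have bd: "b dvd int d" by (simp add: coprime_dvd_mult_right_iff)
  have "\<not> int p dvd b" if "prime p" "p \<notin> S" for p
    using that d bd by (meson dvd_trans int_dvd_int_iff smooth_def)
  then show "r \<in> S_integers S" using ab by (auto simp: S_integers_def)
qed

lemma S_unitsI:
  assumes "smooth S a" "smooth S b"
  shows "of_nat a / of_nat b \<in> S_units S"
proof -
  have pos: "a > 0" "b > 0" using assms by (auto simp: smooth_def)
  have "of_nat a / of_nat b \<in> S_integers S" "of_nat b / of_nat a \<in> S_integers S"
    unfolding S_integers_iff using assms by (metis of_int_of_nat_eq)+
  moreover have "of_nat a / of_nat b * (of_nat b / of_nat a) = (1 :: rat)"
    using pos by simp
  ultimately show ?thesis unfolding S_units_def by blast
qed

text \<open>The inverse is some \<open>n / d\<close> with \<open>d\<close> smooth, hence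
  \<open>a * n = b * d\<close>, and divisors of smooth numbers are smooth.\<close>

lemma S_unitsD:
  assumes "of_nat a / of_nat b \<in> S_units S" "smooth S b"
  shows "smooth S a"
proof -
  have b: "b > 0" using assms by (auto simp: smooth_def)
  obtain v where v: "v \<in> S_integers S" "of_nat a / of_nat b * v = (1 :: rat)"
    using assms(1) by (auto simp: S_units_def)
  then have a: "a > 0" by (cases "a = 0") auto
  obtain n d where nd: "smooth S d" "v = of_int n / of_nat d"
    using v(1) by (auto simp: S_integers_iff)
  have d: "d > 0" using nd by (auto simp: smooth_def)
  have "of_int (int a * n) = (of_int (int b * int d) :: rat)"
    using v(2) nd(2) b d by (simp add: field_simps)
  then have "int a * n = int b * int d" by (simp only: of_int_eq_iff)
  then have "int a dvd int (b * d)" by (metis dvd_triv_left of_nat_mult)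
  then have "a dvd b * d" by (simp only: int_dvd_int_iff)
  moreover have "smooth S (b * d)" using nd assms by (simp add: smooth_mult_iff)
  ultimately show ?thesis by (metis dvdE smooth_mult_iff)
qed

text \<open>If every exponent in the factorisation of \<open>w\<close> were below \<open>e\<close>,
  then \<open>w\<close> would be at most the product of all \<open>p ^ e\<close>.\<close>

lemma smooth_large:
  assumes "finite S" "\<And>p. p \<in> S \<Longrightarrow> prime p" "smooth S w" "w > (\<Prod>S) ^ e"
  shows "\<exists>p \<in> S. p ^ e dvd w"
proof (rule ccontr)
  assume neg: "\<not> (\<exists>p \<in> S. p ^ e dvd w)"
  have w: "w > 0" using assms by (simp add: smooth_def)
  have sub: "prime_factors w \<subseteq> S" using assms(3) by (auto simp: smooth_def)
  have "w = (\<Prod>p \<in> prime_factors w. p ^ multiplicity p w)"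
    using w by (simp add: prime_factorization_nat)
  also have "\<dots> \<le> (\<Prod>p \<in> prime_factors w. p ^ e)"
  proof (intro prod_mono conjI)
    fix p assume p: "p \<in> prime_factors w"
    have "multiplicity p w < e"
      using neg sub p by (meson in_mono linorder_not_less multiplicity_dvd')
    then show "p ^ multiplicity p w \<le> p ^ e"
      using p by (intro power_increasing prime_ge_1_nat) auto
  qed simp
  also have "\<dots> \<le> (\<Prod>p \<in> S. p ^ e)"
  proof (rule dvd_imp_le)
    show "(\<Prod>p \<in> prime_factors w. p ^ e) dvd (\<Prod>p \<in> S. p ^ e)"
      using assms sub by (intro prod_dvd_prod_subset) auto
    show "0 < (\<Prod>p \<in> S. p ^ e)"
      using assms by (auto intro!: prod_pos simp: prime_gt_0_nat)
  qed
  also have "\<dots> = (\<Prod>S) ^ e" by (simp add: prod_power_distrib)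
  finally show False using assms by simp
qed

section \<open>Block sums and bounded valuations\<close>

text \<open>After multiplication by \<open>G - 1\<close>, each full block contributes
  \<open>G ^ N - 1\<close> and the unfinished one \<open>G ^ (t mod N) - 1\<close>. Differences of
  these prefix sums evaluate windows.\<close>

lemma sum_power_mod:
  fixes G :: int
  assumes "N > 0"
  shows "(G - 1) * (\<Sum>i<t. G ^ (i mod N)) = int (t div N) * (G ^ N - 1) + G ^ (t mod N) - 1"
proof (induction t)
  case (Suc t)
  have "t mod N < N" using assms by simp
  moreover have "G * G ^ (t mod N) = G ^ N" if "Suc (t mod N) = N"
    using that by (metis power_Suc)
  ultimately show ?case using Suc
    by (auto simp: mod_Suc div_Suc algebra_simps)
qed simp

lemma pow_ndvd:
  fixes y :: int
  assumes "y \<noteq> 0" "\<bar>y\<bar> < 2 ^ e" "p \<ge> (2::nat)"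
  shows "\<not> int p ^ e dvd y"
proof
  assume "int p ^ e dvd y"
  then have "\<bar>int p ^ e\<bar> \<le> \<bar>y\<bar>" by (rule dvd_imp_le_int[OF assms(1)])
  moreover have "(2::int) ^ e \<le> int p ^ e" using assms(3) by (intro power_mono) auto
  ultimately show False using assms(2) by linarith
qed

text \<open>In the two excluded cases the number is \<open>G^a\<close> and 0, respectively.\<close>
lemma valuation_bound:
  fixes G p :: nat and d :: int
  assumes G: "G \<ge> 2" and p: "p \<ge> 2" "p dvd G"
    and d: "1 \<le> d" "d \<le> int G - 1" "\<not> (d = 1 \<and> b = 0)" "\<not> (d = int G - 1 \<and> a = 0 \<and> b = 1)"
  shows "\<not> int p ^ (G ^ 3) dvd d + int G ^ a - int G ^ b"
proof
  let ?Y = "d + int G ^ a - int G ^ b"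
  assume Y: "int p ^ (G ^ 3) dvd ?Y"
  have pG: "int p ^ e dvd int G ^ c" if "e \<le> c" for e c
    by (rule dvd_trans[OF le_imp_power_dvd[OF that] dvd_power_same]) (use p in simp)
  have pY: "int p ^ e dvd ?Y" if "e \<le> G ^ 3" for e
    by (rule dvd_trans[OF le_imp_power_dvd[OF that] Y])
  have G2: "int G < 2 ^ G" by (metis of_nat_less_iff less_exp of_nat_numeral of_nat_power)
  have Gpow: "int G ^ n < 2 ^ (G * n)" if "n > 0" for n
    using power_strict_mono[OF G2, of n] that by (simp add: power_mult)
  \<comment> \<open>\<open>G ^ c\<close> is at most \<open>X = G ^ (n - 1)\<close>, and
    \<open>G - 1 + X\<close> is at most \<open>G * X\<close> since \<open>X\<close> is at least
    1.\<close>
  have low: "d + int G ^ c \<le> int G ^ n" if "c < n" for c n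
  proof -
    define X where "X = int G ^ (n - 1)"
    have "int G ^ c \<le> X" unfolding X_def using that G by (intro power_increasing) auto
    moreover have "int G ^ n = int G * X"
      using that by (simp add: X_def power_eq_if)
    moreover have "(int G - 1) * 1 \<le> (int G - 1) * X"
      unfolding X_def using G by (intro mult_left_mono) auto
    then have "int G - 1 \<le> int G * X - X" by (simp add: left_diff_distrib)
    ultimately show "d + int G ^ c \<le> int G ^ n"
      using d(1,2) by linarith
  qed
  have exps: "G \<le> G ^ 3" "G ^ 2 \<le> G ^ 3" "G \<le> G ^ 2"
    using G by (auto simp: power2_eq_square power3_eq_cube)
  have Gd: "\<not> int G dvd d" using d(1,2) zdvd_not_zless[of d "int G"] by auto
  have Y0: "?Y \<noteq> 0"
  proof
    assume 0: "?Y = 0"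
    consider "a > 0" "b > 0" | "a = 0" "b = 0" | "a > 0" "b = 0" | "a = 0" "b > 0" by auto
    then show False
    proof cases
      case 1
      then have "int G dvd int G ^ b - int G ^ a" by (intro dvd_diff dvd_power) auto
      moreover have "int G ^ b - int G ^ a = d" using 0 by linarith
      ultimately show False using Gd by simp
    next
      case 2
      then show False using 0 d(1) by simp
    next
      case 3
      then have "d + int G ^ a = 1" using 0 by simp
      moreover have "int G ^ a > 0" using G by simp
      ultimately show False using d(1) by linarith
    next
      case 4
      then have *: "int G ^ b = d + 1" using 0 by simp
      have "\<not> 2 \<le> b"
      proof
        assume "2 \<le> b"
        then have "int G ^ 2 \<le> int G ^ b" using G by (intro power_increasing) auto
        moreover have "int G * 1 < int G * int G" using G by (intro mult_strict_left_mono) auto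
        ultimately show False using * d(2) by (simp add: power2_eq_square)
      qed
      then have "b = 1" using 4 by simp
      then show False using * d(4) 4 by simp
    qed
  qed
  \<comment> \<open>Large exponents vanish modulo \<open>p ^ G\<close> or
    \<open>p ^ (G ^ 2)\<close>, leaving a nonzero remainder smaller than the modulus. If both
    exponents are below \<open>G ^ 2\<close>, then \<open>?Y\<close> itself is too small for
    \<open>p ^ (G ^ 3)\<close>.\<close>
  consider "a \<ge> G" "b \<ge> G" | "a < G" "b \<ge> G ^ 2" | "b < G" "a \<ge> G ^ 2" | "a < G ^ 2" "b < G ^ 2"
    using exps by linarith
  then show False
  proof cases
    case 1
    have "int p ^ G dvd ?Y - int G ^ a + int G ^ b"
      by (rule dvd_add[OF dvd_diff[OF pY[OF exps(1)] pG] pG]) (fact 1)+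
    then have "int p ^ G dvd d" by simp
    then show False using pow_ndvd[of d G p, OF _ _ p(1)] d(1,2) G2 by linarith
  next
    case 2
    have "int p ^ G\<^sup>2 dvd ?Y + int G ^ b"
      by (rule dvd_add[OF pY[OF exps(2)] pG]) (fact 2)
    then have *: "int p ^ G\<^sup>2 dvd d + int G ^ a" by simp
    have "d + int G ^ a < 2 ^ G\<^sup>2"
      using low[OF 2(1)] Gpow[of G] G by (simp add: power2_eq_square)
    moreover have "d + int G ^ a > 0" using d(1) by (simp add: add_pos_nonneg)
    ultimately show False using pow_ndvd[of "d + int G ^ a", OF _ _ p(1)] * by (metis abs_of_pos less_irrefl)
  next
    case 3
    have "int p ^ G\<^sup>2 dvd ?Y - int G ^ a"
      by (rule dvd_diff[OF pY[OF exps(2)] pG]) (fact 3)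
    then have *: "int p ^ G\<^sup>2 dvd d - int G ^ b" by simp
    \<comment> \<open>For \<open>b = 0\<close> this is the excluded case \<open>d = 1\<close>;
      otherwise \<open>G\<close> divides \<open>G ^ b\<close> but not \<open>d\<close>.\<close>
    have "d - int G ^ b \<noteq> 0"
    proof (cases "b = 0")
      case False
      then have "int G dvd int G ^ b" by (intro dvd_power) auto
      then show ?thesis using Gd by auto
    qed (use d(1,3) in simp)
    moreover have "\<bar>d - int G ^ b\<bar> < 2 ^ G\<^sup>2"
    proof -
      have "d + int G ^ b < 2 ^ G\<^sup>2"
        using low[OF 3(1)] Gpow[of G] G by (simp add: power2_eq_square)
      moreover have "int G ^ b \<ge> 0" by simp
      ultimately show ?thesis using d(1) by linarith
    qed
    ultimately show False using pow_ndvd[of "d - int G ^ b", OF _ _ p(1)] * by blast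
  next
    case 4
    define E :: int where "E = 2 ^ (G ^ 3)"
    have "G * G\<^sup>2 = G ^ 3" by (simp add: power3_eq_cube power2_eq_square)
    then have "int G ^ G\<^sup>2 < E" using Gpow[of "G\<^sup>2"] G by (simp add: E_def)
    moreover have "int G ^ a \<ge> 0" "int G ^ b \<ge> 0" by simp_all
    ultimately have "?Y < E" "- ?Y < E"
      using low[OF 4(1)] low[OF 4(2)] d(1) by linarith+
    then have "\<bar>?Y\<bar> < 2 ^ (G ^ 3)" unfolding abs_less_iff E_def by blast
    from pow_ndvd[OF Y0 this p(1)] Y show False by (rule notE)
  qed
qed

section \<open>Proper windows are not units\<close>

text \<open>Here \<open>c\<close> collects the cofactors of the interleaved terms.
  \<open>nontriv\<close> rules out a window that is a single power of \<open>G\<close>; the full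
  range is exempt because its sum \<open>G ^ N\<close> can be completed to a smooth total.\<close>

lemma window_not_smooth:
  fixes S :: "nat set" and G N s t c :: nat
  assumes S: "finite S" "S \<noteq> {}" "\<And>p. p \<in> S \<Longrightarrow> prime p"
    and G: "G = \<Prod>S" and N: "N \<ge> G ^ 3 + 2"
    and st: "s < t" "t \<le> N * (G - 1) + 1" "(s, t) \<noteq> (0, N * (G - 1) + 1)"
    and nontriv: "t \<ge> s + 2 \<or> c > 0"
  shows "\<not> smooth S ((\<Sum>i \<in> {s..<t}. G ^ (i mod N)) + G ^ N * c)"
proof
  let ?V = "\<Sum>i \<in> {s..<t}. G ^ (i mod N)"
  let ?w = "?V + G ^ N * c"
  assume smooth: "smooth S ?w"
  have pG: "p dvd G" if "p \<in> S" for p using that S G by (auto intro: dvd_prodI)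
  obtain p0 where p0: "p0 \<in> S" using S by auto
  have G0: "G > 0" using S G by (auto intro!: prod_pos simp: prime_gt_0_nat)
  have G2: "G \<ge> 2" using pG[OF p0] S(3)[OF p0] G0 by (meson dvd_imp_le le_trans prime_ge_2_nat)
  define a b i l where "a = s mod N" and "b = t mod N" and "i = s div N" and "l = t div N"
  have aN: "a < N" "b < N" using N by (auto simp: a_def b_def)
  have s: "s = i * N + a" and t: "t = l * N + b" by (auto simp: a_def b_def i_def l_def)
  show False
  \<comment> \<open>In the first case the window stays inside block \<open>i\<close>, so its first
    term is \<open>G ^ a\<close> and all other terms are divisible by
    \<open>G ^ (a + 1)\<close>.\<close>
  proof (cases "t \<le> (i + 1) * N")
    case True
    have "G ^ (a + 1) dvd (\<Sum>j \<in> {Suc s..<t}. G ^ (j mod N))"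
    proof (rule dvd_sum)
      fix j assume j: "j \<in> {Suc s..<t}"
      have "j = i * N + (j - i * N)" "j - i * N < N" using j True s by auto
      then have "j mod N = j - i * N" by (metis mod_less mod_mult_self3)
      then have "a + 1 \<le> j mod N" using j s by auto
      then show "G ^ (a + 1) dvd G ^ (j mod N)" by (rule le_imp_power_dvd)
    qed
    moreover have "G ^ (a + 1) dvd G ^ N * c" using aN by (intro dvd_mult2 le_imp_power_dvd) auto
    ultimately have "G ^ (a + 1) dvd (\<Sum>j \<in> {Suc s..<t}. G ^ (j mod N)) + G ^ N * c" (is "_ dvd ?r")
      by (rule dvd_add)
    then obtain x where x: "?r = G ^ (a + 1) * x" by blast
    have w: "?w = G ^ a + ?r" using st by (simp add: sum.atLeast_Suc_lessThan a_def)
    have "?r > 0"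
    proof (cases "c > 0")
      case False
      then have "Suc s < t" using nontriv by auto
      then have "(\<Sum>j \<in> {Suc s..<t}. G ^ (j mod N)) > 0"
        using G0 by (intro sum_pos) auto
      then show ?thesis by simp
    qed (use G0 in simp)
    then have x0: "x > 0" using x by (cases x) auto
    have "?w = G ^ a * (1 + G * x)" using w x by (simp add: algebra_simps)
    then have sm: "smooth S (1 + G * x)" using smooth by (simp only: smooth_mult_iff)
    have "1 + G * x \<noteq> 1" using x0 G0 by simp
    then obtain p where p: "prime p" "p dvd 1 + G * x" using prime_factor_nat by blast
    then have "p \<in> S" using sm by (auto simp: smooth_def)
    then have "p dvd G * x" using pG by auto
    then have "p dvd 1" using p(2) by (metis dvd_add_left_iff)
    then show False using p(1) by auto
  next
    case False
    \<comment> \<open>\<open>d\<close> is the multiple of \<open>G ^ N - 1\<close> that survives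
      when prefix sums are subtracted. It is at most \<open>G - 1\<close>, since
      \<open>N \<ge> 2\<close> keeps \<open>t\<close> below \<open>G * N\<close>.\<close>
    define d where "d = int l - int i"
    have G1: "l \<le> G - 1"
    proof (rule ccontr)
      assume "\<not> l \<le> G - 1"
      then have "G * N \<le> l * N" using G0 by (intro mult_right_mono) auto
      then have "G * N \<le> N * (G - 1) + 1" using t st(2) by linarith
      moreover have "G * N = N * (G - 1) + N" using G0 by (cases G) auto
      ultimately show False using N by simp
    qed
    have il: "i + 1 \<le> l"
    proof (rule ccontr)
      assume "\<not> i + 1 \<le> l"
      then have "(l + 1) * N \<le> (i + 1) * N" by (intro mult_right_mono) auto
      then show False using False t aN unfolding add_mult_distrib by linarith
    qed
    \<comment> \<open>The last term \<open>G ^ (N - 1)\<close> of block \<open>i\<close> lies in the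
      window, and \<open>N - 1\<close> exceeds \<open>G ^ 3\<close>.\<close>
    have "\<exists>p \<in> S. p ^ (G ^ 3) dvd ?w"
      unfolding G
    proof (rule smooth_large[OF S(1,3) smooth[unfolded G]], simp_all flip: G)
      have "(i + 1) * N - 1 \<in> {s..<t}" using False s aN N by auto
      moreover have "((i + 1) * N - 1) mod N = N - 1"
      proof -
        have "(i + 1) * N - 1 = i * N + (N - 1)" using N by simp
        then show ?thesis using N
          by (metis mod_less mod_mult_self3 diff_less less_numeral_extra(1) aN(1) gr0I less_nat_zero_code)
      qed
      ultimately have "G ^ (N - 1) \<le> ?V"
        by (metis (no_types, lifting) member_le_sum finite_atLeastLessThan zero_le)
      moreover have "G ^ (G ^ 3) < G ^ (N - 1)"
        using G2 N by (intro power_strict_increasing) auto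
      ultimately show "G ^ (G ^ 3) < ?w" by linarith
    qed
    then obtain p where p: "p \<in> S" "p ^ (G ^ 3) dvd ?w" by blast
    have "int p ^ (G ^ 3) dvd int ?w" using p(2) by (metis int_dvd_int_iff of_nat_power)
    then have 1: "int p ^ (G ^ 3) dvd (int G - 1) * int ?w" by (rule dvd_mult)
    have "int p ^ (G ^ 3) dvd int G ^ (G ^ 3)" using pG[OF p(1)] by (intro dvd_power_same) simp
    then have 2: "int p ^ (G ^ 3) dvd int G ^ N"
      using N by (meson dvd_trans le_imp_power_dvd add_leD1)
    have N0: "N > 0" using N by simp
    have split: "(\<Sum>j<t. int G ^ (j mod N)) = (\<Sum>j<s. int G ^ (j mod N)) + (\<Sum>j\<in>{s..<t}. int G ^ (j mod N))"
      using st(1) by (subst sum.union_disjoint[symmetric]) (auto intro!: sum.cong)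
    have "(int G - 1) * int ?V = d * (int G ^ N - 1) + int G ^ b - int G ^ a"
      using sum_power_mod[OF N0, of "int G" t] sum_power_mod[OF N0, of "int G" s] split
      by (simp add: d_def a_def b_def i_def l_def algebra_simps)
    then have "d + int G ^ a - int G ^ b =
        int G ^ N * (d + (int G - 1) * int c) - (int G - 1) * int ?w"
      by (simp add: algebra_simps)
    then have "int p ^ (G ^ 3) dvd d + int G ^ a - int G ^ b"
      using 1 2 by (metis dvd_diff dvd_mult2)
    moreover have "\<not> int p ^ (G ^ 3) dvd d + int G ^ a - int G ^ b"
    proof (rule valuation_bound[OF G2 _ pG[OF p(1)]])
      show "2 \<le> p" using S p by (simp add: prime_ge_2_nat)
      show "1 \<le> d" "d \<le> int G - 1" using il G1 G0 by (auto simp: d_def)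
      \<comment> \<open>Such a window ends exactly with block \<open>i\<close>, which the first case
        covers.\<close>
      show "\<not> (d = 1 \<and> b = 0)"
      proof
        assume "d = 1 \<and> b = 0"
        then have "l = i + 1" "b = 0" by (auto simp: d_def)
        then show False using False t by simp
      qed
      \<comment> \<open>These values describe the full range, excluded by \<open>st\<close>.\<close>
      show "\<not> (d = int G - 1 \<and> a = 0 \<and> b = 1)"
      proof
        assume *: "d = int G - 1 \<and> a = 0 \<and> b = 1"
        then have "l = G - 1" "i = 0" using G1 G0 by (auto simp: d_def)
        then show False using * s t st by (simp add: mult.commute)
      qed
    qed
    ultimately show False by blast
  qed
qed

section \<open>Interleaving two sequences\<close>

text \<open>The order is \<open>v 0, e 0, v 1, e 1, ...\<close> for \<open>2 * R\<close> places,
  then the rest of \<open>v\<close>. A prefix consists of initial segments of \<open>v\<close> and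
  \<open>e\<close>, so a window splits into one interval of each.\<close>

lemma sum_interleave:
  fixes v e :: "nat \<Rightarrow> nat" and R :: nat
  defines "f \<equiv> \<lambda>n. if n < 2 * R then (if even n then v (n div 2) else e (n div 2)) else v (n - R)"
  shows "(\<Sum>i<n. f i) = (\<Sum>i < (if n \<le> 2 * R then (n + 1) div 2 else n - R). v i) + (\<Sum>i < min (n div 2) R. e i)"
proof (induction n)
  case (Suc n)
  consider "n < 2 * R" "even n" | "n < 2 * R" "odd n" | "n \<ge> 2 * R" by linarith
  then show ?case
  proof cases
    case 1
    then obtain q where "n = 2 * q" by blast
    then show ?thesis using Suc 1 by (simp add: f_def min_def)
  next
    case 2
    then obtain q where "n = 2 * q + 1" by (metis oddE)
    then show ?thesis using Suc 2 by (simp add: f_def min_def)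
  next
    case 3
    then have "min (n div 2) R = R" "min (Suc n div 2) R = R" by auto
    moreover have "(if n \<le> 2 * R then (n + 1) div 2 else n - R) = n - R" using 3 by auto
    moreover have "Suc n - R = Suc (n - R)" using 3 by auto
    ultimately show ?thesis using Suc 3 by (simp add: f_def)
  qed
qed simp

section \<open>Possible numbers of additional terms\<close>

text \<open>The \<open>R\<close> terms \<open>G ^ N * y i\<close> raise a total of
  \<open>G ^ N\<close> to another smooth number; the leading 1 stands for the original
  total.\<close>

definition smooth_split :: "nat set \<Rightarrow> nat \<Rightarrow> bool" where
  "smooth_split S R \<longleftrightarrow> (\<exists>y. (\<forall>i<R. smooth S (y i)) \<and> smooth S (1 + (\<Sum>i<R. y i)))"

text \<open>The first family raises 1 to \<open>H\<close>; the second, scaled by \<open>H\<close>,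
  then multiplies the total by its own smooth sum.\<close>

lemma smooth_split_add:
  assumes "smooth_split S a" "smooth_split S b"
  shows "smooth_split S (a + b)"
proof -
  obtain y z where y: "\<forall>i<a. smooth S (y i)" "smooth S (1 + (\<Sum>i<a. y i))"
    and z: "\<forall>i<b. smooth S (z i)" "smooth S (1 + (\<Sum>i<b. z i))"
    using assms unfolding smooth_split_def by blast
  define H where "H = 1 + (\<Sum>i<a. y i)"
  define x where "x = (\<lambda>i. if i < a then y i else H * z (i - a))"
  have H: "smooth S H" using y(2) by (simp only: H_def)
  have "(\<Sum>i<a+b. x i) = (\<Sum>i<a. x i) + (\<Sum>i<b. x (a + i))"
    by (induction b) auto
  also have "\<dots> = (\<Sum>i<a. y i) + H * (\<Sum>i<b. z i)"
    by (simp add: x_def sum_distrib_left)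
  finally have "1 + (\<Sum>i<a+b. x i) = H * (1 + (\<Sum>i<b. z i))"
    by (simp add: H_def)
  then have "smooth S (1 + (\<Sum>i<a+b. x i))"
    using y z by (simp only: smooth_mult_iff H_def)
  moreover have "\<forall>i<a+b. smooth S (x i)"
    using y z H by (auto simp: x_def smooth_mult_iff)
  ultimately show ?thesis unfolding smooth_split_def by blast
qed

text \<open>Adding \<open>p - 1\<close> ones to 1 gives \<open>p\<close>.\<close>

lemma smooth_split_prime:
  assumes "prime p" "p \<in> S"
  shows "smooth_split S (p - 1)"
  unfolding smooth_split_def
  using assms smooth_prime[OF assms] prime_gt_0_nat[OF assms(1)]
  by (intro exI[of _ "\<lambda>_. 1"]) simp

text \<open>The Frobenius coin argument, by induction on \<open>A\<close>: copies of the new element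
  \<open>a\<close> correct the residue modulo \<open>g = Gcd A\<close>, and the large multiple of
  \<open>g\<close> that remains falls under the induction hypothesis.\<close>

lemma eventually_multiples_closed:
  fixes P :: "nat \<Rightarrow> bool"
  assumes add: "\<And>a b. P a \<Longrightarrow> P b \<Longrightarrow> P (a + b)"
    and A: "finite A" "A \<noteq> {}" "\<And>a. a \<in> A \<Longrightarrow> P a \<and> a > 0"
  shows "\<exists>K. \<forall>n\<ge>K. Gcd A dvd n \<longrightarrow> P n"
  using A
proof (induction rule: finite_ne_induct)
  case (singleton a)
  \<comment> \<open>Counting starts at one copy because \<open>P 0\<close> is not given.\<close>
  have mult: "P (Suc n * a)" for n
    using singleton by (induction n) (auto intro: add)
  have "P n" if "n \<ge> 1" "a dvd n" for n
  proof -
    obtain q where "n = a * q" using \<open>a dvd n\<close> by (rule dvdE)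
    then show ?thesis using mult[of "q - 1"] that by (cases q) (auto simp: mult.commute)
  qed
  then show ?case by (auto intro!: exI[of _ 1])
next
  case (insert a A)
  obtain K where K: "\<And>n. n \<ge> K \<Longrightarrow> Gcd A dvd n \<Longrightarrow> P n" using insert by blast
  define g where "g = Gcd A"
  have Pa: "P a" "a > 0" using insert by auto
  have g: "g > 0"
  proof -
    obtain x where "x \<in> A" using insert by auto
    then have "g dvd x" "x > 0" using insert by (auto simp: g_def)
    then show ?thesis by (cases g) auto
  qed
  have step: "P (n + v * a)" if "P n" for n v
    using that by (induction v) (auto simp: add.left_commute[of n a] intro: add[OF Pa(1)] simp del: add.assoc)
  have "P n" if n: "n \<ge> K + g * a" "gcd a g dvd n" for n
  proof -
    \<comment> \<open>Bezout scaled by \<open>q\<close> shows that \<open>x * q\<close> copies of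
      \<open>a\<close> have the residue of \<open>n\<close> modulo \<open>g\<close>.\<close>
    obtain x y where "a * x = g * y + gcd a g" using bezout_nat[of a g] Pa by auto
    moreover obtain q where q: "n = gcd a g * q" using n by blast
    ultimately have "a * (x * q) = g * (y * q) + n" by (metis add_mult_distrib mult.assoc)
    then have c: "[a * (x * q) = n] (mod g)" by (simp add: cong_def)
    \<comment> \<open>Fewer than \<open>g\<close> copies suffice, so at most \<open>g * a\<close> is
      subtracted and at least \<open>K\<close> remains.\<close>
    define v where "v = (x * q) mod g"
    have "[a * v = n] (mod g)"
      using c by (simp add: v_def cong_def mod_mult_right_eq)
    moreover have va: "v * a \<le> g * a" using g by (intro mult_right_mono) (auto simp: v_def less_imp_le)
    ultimately have "g dvd n - v * a"
      using n cong_altdef_nat[of "v * a" n g]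
      by (metis add_leD2 cong_sym_eq le_trans mult.commute)
    then have "P (n - v * a)" using va n
      by (intro K) (linarith, simp add: g_def)
    then have "P (n - v * a + v * a)" by (rule step)
    then show ?thesis using va n by simp
  qed
  then show ?case by (auto simp: g_def)
qed

section \<open>Assembling the sequence for a given \<open>k\<close>\<close>

theorem theorem1p4:
  fixes S :: "nat set" and m :: nat
  assumes "finite S" and "S \<noteq> {}" and "\<And>p. p \<in> S \<Longrightarrow> prime p"
    and "m = Gcd {p - 1 | p. p \<in> S}"
  shows "\<exists>K::nat. \<forall>k::nat. k \<ge> K \<and> [k = 1] (mod m) \<longrightarrow>
    (\<exists>u :: nat \<Rightarrow> rat.
       (\<forall>i \<in> {1..k}. u i \<in> S_units S \<and> u i > 0) \<and>
       (\<Sum>i = 1..k. u i) = 1 \<and>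
       (\<forall>i j. 1 \<le> i \<and> i < j \<and> j \<le> k \<and> (i, j) \<noteq> (1, k) \<longrightarrow>
          (\<Sum>l = i..j. u l) \<notin> S_units S))"
proof -
  define G where "G = \<Prod>S"
  have smG: "smooth S G" unfolding G_def using assms(3) by (intro smooth_prod smooth_prime) auto
  obtain p0 where p0: "p0 \<in> S" using assms by auto
  have "p0 dvd G" unfolding G_def using assms p0 dvd_prodI[of S p0 "\<lambda>x. x"] by auto
  then have G2: "G \<ge> 2" using smG assms(3)[OF p0]
    by (metis smooth_def dvd_imp_le le_trans prime_ge_2_nat)
  have m: "m = Gcd ((\<lambda>p. p - 1) ` S)" unfolding assms(4) by (simp add: Setcompr_eq_image)
  \<comment> \<open>With \<open>G\<close> congruent to 1 modulo \<open>m\<close>, the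
    \<open>N * (G - 1)\<close> block terms do not affect the residue of \<open>k\<close>, so
    \<open>m\<close> will divide \<open>R\<close>.\<close>
  have "[p = 1] (mod m)" if "p \<in> S" for p
  proof -
    have "m dvd p - 1" using that by (auto simp: m)
    then show ?thesis using prime_ge_1_nat[OF assms(3)[OF that]] by (simp add: cong_altdef_nat)
  qed
  then have "[(\<Prod>p\<in>S. p) = (\<Prod>p\<in>S. 1)] (mod m)" by (intro cong_prod)
  then have mG: "m dvd G - 1" using G2 by (simp add: G_def cong_altdef_nat)
  have "\<exists>K. \<forall>n\<ge>K. Gcd ((\<lambda>p. p - 1) ` S) dvd n \<longrightarrow> smooth_split S n"
  proof (rule eventually_multiples_closed)
    fix a assume "a \<in> (\<lambda>p. p - 1) ` S"
    then obtain p where "p \<in> S" "a = p - 1" by auto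
    then show "smooth_split S a \<and> a > 0"
      using assms(3) smooth_split_prime prime_gt_1_nat by auto
  qed (use assms smooth_split_add in auto)
  then obtain R0 where R0: "\<And>n. n \<ge> R0 \<Longrightarrow> m dvd n \<Longrightarrow> smooth_split S n" using m by blast
  \<comment> \<open>Makes the quotient \<open>N\<close> at least \<open>G ^ 3 + 2\<close>, as the
    window lemma demands, and at least \<open>R0 + G\<close>, so that block terms outnumber the
    \<open>R\<close> extra ones.\<close>
  define K where "K = 1 + R0 + (G - 1) * (G ^ 3 + 2 + R0 + G)"
  show ?thesis
  proof (intro exI[of _ K] allI impI, elim conjE)
    fix k :: nat assume k: "k \<ge> K" "[k = 1] (mod m)"
    \<comment> \<open>Division with remainder yields \<open>k = N * (G - 1) + 1 + R\<close>; the
      offset \<open>R0\<close> puts \<open>R\<close> where splits are available.\<close>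
    define N where "N = (k - 1 - R0) div (G - 1)"
    define R where "R = R0 + (k - 1 - R0) mod (G - 1)"
    have "(G - 1) * (G ^ 3 + 2 + R0 + G) \<le> k - 1 - R0" using k by (simp add: K_def)
    then have "G ^ 3 + 2 + R0 + G \<le> N" unfolding N_def
      using G2 by (subst less_eq_div_iff_mult_less_eq) (auto simp: mult.commute)
    then have N: "N \<ge> G ^ 3 + 2" "N \<ge> R0 + G" by auto
    have "k - 1 - R0 = N * (G - 1) + (R - R0)"
      unfolding N_def R_def add_diff_cancel_left' by (rule div_mult_mod_eq[symmetric])
    moreover have "R0 \<le> R" by (simp add: R_def)
    moreover have "1 + R0 \<le> k" using k(1) unfolding K_def by linarith
    ultimately have kN: "k = N * (G - 1) + 1 + R" by linarith
    have "(k - 1 - R0) mod (G - 1) < G - 1" using G2 by (intro mod_less_divisor) simp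
    then have "R < R0 + G" unfolding R_def by linarith
    moreover have "N * 1 \<le> N * (G - 1)" using G2 by (intro mult_left_mono) auto
    ultimately have RM: "R < N * (G - 1) + 1" using N by linarith
    have "m dvd N * (G - 1) + R" using k(2) kN cong_altdef_nat[of 1 k m] by simp
    then have "m dvd R" using mG by (metis dvd_add_right_iff dvd_mult)
    then have "smooth_split S R" using R0 by (simp add: R_def)
    then obtain y where y: "\<forall>i<R. smooth S (y i)" "smooth S (1 + (\<Sum>i<R. y i))"
      unfolding smooth_split_def by blast
    \<comment> \<open>Both the total of the integer sequence and the common denominator of the
      units.\<close>
    define T where "T = G ^ N * (1 + (\<Sum>i<R. y i))"
    have smT: "smooth S T"
      unfolding T_def smooth_mult_iff using y(2) smooth_power[OF smG] by blast
    then have T0: "T > 0" by (simp add: smooth_def)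
    define v where "v = (\<lambda>n. G ^ (n mod N))"
    define e where "e = (\<lambda>n. G ^ N * y n)"
    define f where "f = (\<lambda>n. if n < 2 * R then (if even n then v (n div 2) else e (n div 2)) else v (n - R))"
    define \<alpha> where "\<alpha> = (\<lambda>n. if n \<le> 2 * R then (n + 1) div 2 else n - R)"
    define \<beta> where "\<beta> = (\<lambda>n. min (n div 2) R)"
    have F: "(\<Sum>i<n. f i) = (\<Sum>i<\<alpha> n. v i) + (\<Sum>i<\<beta> n. e i)" for n
      unfolding f_def \<alpha>_def \<beta>_def by (rule sum_interleave)
    have smf: "smooth S (f n)" for n
    proof -
      have "smooth S (v i)" for i by (simp add: v_def smG smooth_power)
      moreover have "smooth S (e i)" if "i < R" for i
        using that y by (simp add: e_def smG smooth_power smooth_mult_iff)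
      ultimately show ?thesis by (auto simp: f_def)
    qed
    have ab: "\<alpha> n + \<beta> n = n" for n unfolding \<alpha>_def \<beta>_def by auto
    have mono: "\<alpha> n1 \<le> \<alpha> n2" "\<beta> n1 \<le> \<beta> n2" if "n1 \<le> n2" for n1 n2
      using that unfolding \<alpha>_def \<beta>_def by (auto simp: div_le_mono min_def)
    \<comment> \<open>Two extra terms are never adjacent, so any two consecutive places include a
      block term.\<close>
    have strict: "\<alpha> n1 < \<alpha> n2" if "n1 + 2 \<le> n2" for n1 n2
      using that unfolding \<alpha>_def by auto
    have \<alpha>k: "\<alpha> k = N * (G - 1) + 1" "\<beta> k = R" using kN RM by (auto simp: \<alpha>_def \<beta>_def)
    have window: "(\<Sum>i\<in>{n1..<n2}. f i) = (\<Sum>i\<in>{\<alpha> n1..<\<alpha> n2}. G ^ (i mod N)) + G ^ N * (\<Sum>i\<in>{\<beta> n1..<\<beta> n2}. y i)"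
      if "n1 \<le> n2" for n1 n2
    proof -
      have sp: "(\<Sum>i<q. h i) = (\<Sum>i<p. h i) + (\<Sum>i\<in>{p..<q}. h i)" if "p \<le> q" for h :: "nat \<Rightarrow> nat" and p q
        using that by (subst sum.union_disjoint[symmetric]) (auto intro!: sum.cong)
      have "(\<Sum>i\<in>{n1..<n2}. f i) = (\<Sum>i\<in>{\<alpha> n1..<\<alpha> n2}. v i) + (\<Sum>i\<in>{\<beta> n1..<\<beta> n2}. e i)"
        using F[of n1] F[of n2] sp[OF that, of f] sp[OF mono(1)[OF that], of v] sp[OF mono(2)[OF that], of e]
        by linarith
      then show ?thesis by (simp add: v_def e_def sum_distrib_left)
    qed
    \<comment> \<open>\<open>f\<close> is indexed from 0 and \<open>u\<close> from 1, so
      \<open>{i..j}\<close> becomes \<open>{i - 1..<j}\<close>.\<close>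
    define u where "u = (\<lambda>l. of_nat (f (l - 1)) / of_nat T :: rat)"
    have usum: "(\<Sum>l = i..j. u l) = of_nat (\<Sum>n\<in>{i - 1..<j}. f n) / of_nat T" if "i \<ge> 1" for i j
    proof -
      have "(\<Sum>l = i..j. u l) = (\<Sum>n\<in>{i - 1..<j}. of_nat (f n) / of_nat T)"
        unfolding u_def using that
        by (intro sum.reindex_bij_witness[of _ Suc "\<lambda>l. l - 1"]) auto
      then show ?thesis by (simp add: sum_divide_distrib)
    qed
    have total: "(\<Sum>n\<in>{0..<k}. f n) = T"
    proof -
      have "N > 0" using N by simp
      \<comment> \<open>There are \<open>G - 1\<close> full blocks and one final term, whose
        contribution \<open>G - 1\<close> cancels the deficit of 1 from each block.\<close>
      have divmod: "(N * (G - 1) + 1) div N = G - 1" "(N * (G - 1) + 1) mod N = 1"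
        using N(1) by (simp_all del: add_Suc_right One_nat_def)
      from sum_power_mod[OF \<open>N > 0\<close>, of "int G" "N * (G - 1) + 1", unfolded divmod]
      have "(int G - 1) * (\<Sum>i<N * (G - 1) + 1. int G ^ (i mod N)) = (int G - 1) * int G ^ N"
        using G2 by (simp add: left_diff_distrib right_diff_distrib of_nat_diff del: sum.lessThan_Suc)
      then have "(\<Sum>i<N * (G - 1) + 1. int G ^ (i mod N)) = int G ^ N"
        using G2 by simp
      then have "int (\<Sum>i<N * (G - 1) + 1. G ^ (i mod N)) = int (G ^ N)" by simp
      then have "(\<Sum>i<N * (G - 1) + 1. G ^ (i mod N)) = G ^ N" by (simp only: of_nat_eq_iff)
      then have "(\<Sum>n<k. f n) = T"
        unfolding F \<alpha>k T_def v_def e_def by (simp add: algebra_simps sum_distrib_left)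
      then show ?thesis by (simp add: atLeast0LessThan)
    qed
    show "\<exists>u :: nat \<Rightarrow> rat.
       (\<forall>i \<in> {1..k}. u i \<in> S_units S \<and> u i > 0) \<and>
       (\<Sum>i = 1..k. u i) = 1 \<and>
       (\<forall>i j. 1 \<le> i \<and> i < j \<and> j \<le> k \<and> (i, j) \<noteq> (1, k) \<longrightarrow>
          (\<Sum>l = i..j. u l) \<notin> S_units S)"
    proof (intro exI[of _ u] conjI ballI allI impI)
      fix i
      show "u i \<in> S_units S" unfolding u_def by (intro S_unitsI smf smT)
      show "u i > 0" using smf[of "i - 1"] T0 by (simp add: u_def smooth_def)
    next
      show "(\<Sum>i = 1..k. u i) = 1" using usum[of 1 k] total T0 by simp
    next
      fix i j assume ij: "1 \<le> i \<and> i < j \<and> j \<le> k \<and> (i, j) \<noteq> (1, k)"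
      define s t where "s = \<alpha> (i - 1)" and "t = \<alpha> j"
      have st: "s < t" unfolding s_def t_def using ij by (intro strict) auto
      have tk: "t \<le> N * (G - 1) + 1" unfolding t_def \<alpha>k(1)[symmetric] using ij by (intro mono) auto
      \<comment> \<open>Place 0 holds a block term, and so does the last place because
        \<open>k > 2 * R\<close>; dropping either end therefore changes \<open>s\<close> or
        \<open>t\<close>.\<close>
      have ne: "(s, t) \<noteq> (0, N * (G - 1) + 1)"
      proof
        assume "(s, t) = (0, N * (G - 1) + 1)"
        then have *: "\<alpha> (i - 1) = 0" "\<alpha> j = \<alpha> k" by (auto simp: s_def t_def \<alpha>k)
        have "i = 1" using *(1) ij by (auto simp: \<alpha>_def split: if_splits)
        moreover have "j = k" using *(2) ij kN RM by (auto simp: \<alpha>_def split: if_splits)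
        ultimately show False using ij by simp
      qed
      have nontriv: "t \<ge> s + 2 \<or> (\<Sum>n\<in>{\<beta> (i - 1)..<\<beta> j}. y n) > 0"
      proof (cases "t \<ge> s + 2")
        case False
        \<comment> \<open>The window has at least two terms but only one block term, so by
          \<open>ab\<close> it contains an extra term.\<close>
        then have lt: "\<beta> (i - 1) < \<beta> j" using ab[of "i - 1"] ab[of j] ij st by (auto simp: s_def t_def)
        have "(\<Sum>n\<in>{\<beta> (i - 1)..<\<beta> j}. y n) > 0"
        proof (rule sum_pos)
          fix n assume "n \<in> {\<beta> (i - 1)..<\<beta> j}"
          then have "n < R" by (auto simp: \<beta>_def)
          then show "y n > 0" using y by (auto simp: smooth_def)
        qed (use lt in auto)
        then show ?thesis ..
      qed simp
      have "i - 1 \<le> j" using ij by linarith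
      then have "\<not> smooth S (\<Sum>n\<in>{i - 1..<j}. f n)"
        using window_not_smooth[OF assms(1-3) G_def N(1) st tk ne nontriv]
        by (simp only: window s_def t_def not_False_eq_True)
      then show "(\<Sum>l = i..j. u l) \<notin> S_units S"
        using usum ij S_unitsD smT by metis
    qed
  qed
qed

end
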